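(* Interpret the sequent rules of G4ip (listed in the context) as relations between exponential polynomials, taking the value of a rule's premise to be the product of the values of its premises (the empty product $1$ if there are none). If the variables $F,G,H,I,P$ are interpreted as natural numbers strictly greater than $1$ (and $\Gamma$ as a natural number $\ge 1$), then for every rule of G4ip the value of the premise is less than or equal to the value of the conclusion; moreover the inequality is strict if and only if the rule is non-invertible. Explicitly (premise vs. conclusion): invertible rules (equality): $(\to_r)$: $G^{F\Gamma}$ vs $(G^F)^\Gamma$; $(\wedge_r)$: $F^\Gamma G^\Gamma$ vs $(FG)^\Gamma$; $(\vee_l)$: $H^{F\Gamma}H^{G\Gamma}$ vs $H^{(F+G)\Gamma}$; $(\wedge_l)$: $H^{FG\Gamma}$ vs $H^{FG\Gamma}$; $(\to_l^\wedge)$: $I^{(H^G)^F\Gamma}$ vs $I^{H^{GF}\Gamma}$; $(\to_l^\vee)$: $I^{H^FH^G\Gamma}$ vs $I^{H^{F+G}\Gamma}$; non-invertible rules (strict inequality): (axiom): $1$ vs $P^{P\Gamma}$; $(\vee_r^1)$: $F^\Gamma$ vs $(F+G)^\Gamma$; $(\vee_r^2)$: $G^\Gamma$ vs $(F+G)^\Gamma$; $(\to_l^P)$: $G^{FP\Gamma}$ vs $G^{F^PP\Gamma}$; $(\to_l^\to)$: $(G^F)^{H^G\Gamma}I^{H\Gamma}$ vs $I^{H^{G^F}\Gamma}$.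
   Context: G4ip is the following sequent calculus for intuitionistic (minimal) propositional logic ($P$ atomic, $\Gamma$ a multiset of formulas): axiom $P,\Gamma\Rightarrow P$; $(\to_r)$ from $F,\Gamma\Rightarrow G$ infer $\Gamma\Rightarrow F\to G$; $(\wedge_r)$ from $\Gamma\Rightarrow F$ and $\Gamma\Rightarrow G$ infer $\Gamma\Rightarrow F\wedge G$; $(\vee_l)$ from $F,\Gamma\Rightarrow H$ and $G,\Gamma\Rightarrow H$ infer $F\vee G,\Gamma\Rightarrow H$; $(\wedge_l)$ from $F,G,\Gamma\Rightarrow H$ infer $F\wedge G,\Gamma\Rightarrow H$; $(\to_l^\wedge)$ from $F\to G\to H,\Gamma\Rightarrow I$ infer $G\wedge F\to H,\Gamma\Rightarrow I$; $(\to_l^\vee)$ from $F\to H,G\to H,\Gamma\Rightarrow I$ infer $F\vee G\to H,\Gamma\Rightarrow I$; $(\vee_r^1)$/$(\vee_r^2)$ from $\Gamma\Rightarrow F$ (resp. $\Gamma\Rightarrow G$) infer $\Gamma\Rightarrow F\vee G$; $(\to_l^P)$ from $F,P,\Gamma\Rightarrow G$ infer $P\to F,P,\Gamma\Rightarrow G$; $(\to_l^\to)$ from $G\to H,\Gamma\Rightarrow F\to G$ and $H,\Gamma\Rightarrow I$ infer $(F\to G)\to H,\Gamma\Rightarrow I$. The rules $(\to_r),(\wedge_r),(\vee_l),(\wedge_l),(\to_l^\wedge),(\to_l^\vee)$ are called invertible, the others non-invertible. A sequent $\Gamma\Rightarrow F$ is read as the exponential polynomial $F^{\Gamma}$, where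 a context is read as the product of its formulas, $F\wedge G$ as $FG$, $F\vee G$ as $F+G$, and $F\to G$ as $G^F$; the displayed expressions in the claim are the resulting readings of premises and conclusions. *)

theory Defs
  imports "HOL-Library.Multiset"
begin

datatype 'a fm =
    Atom 'a
  | Imp "'a fm" "'a fm" (infixr "\<rightarrow>\<^sub>f" 60)
  | Conj "'a fm" "'a fm" (infixr "\<and>\<^sub>f" 64)
  | Disj "'a fm" "'a fm" (infixr "\<or>\<^sub>f" 62)

datatype 'a sequent = Seq "'a fm multiset" "'a fm" (infix "\<Rightarrow>\<^sub>s" 50)

datatype rule = Ax | ImpR | ConjR | DisjL | ConjL | ImpConjL | ImpDisjL
  | DisjR1 | DisjR2 | ImpAtomL | ImpImpL

text \<open>
  A rule of G4ip is a schema in the formula variables F, G, H, I, the atom variable P and the context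
  variable \<open>\<Gamma>\<close>. For uniformity every schema takes all six variables, although most
  rules mention only some of them. The instances of the rule \<open>r\<close> are exactly the pairs
  \<open>(rule_prems r F G H I P \<Gamma>, rule_concl r F G H I P \<Gamma>)\<close>.
\<close>

fun rule_prems ::
  "rule \<Rightarrow> 'a fm \<Rightarrow> 'a fm \<Rightarrow> 'a fm \<Rightarrow> 'a fm \<Rightarrow> 'a \<Rightarrow> 'a fm multiset \<Rightarrow> 'a sequent list" where
  "rule_prems Ax       F G H I P \<Gamma> = []"
| "rule_prems ImpR     F G H I P \<Gamma> = [{#F#} + \<Gamma> \<Rightarrow>\<^sub>s G]"
| "rule_prems ConjR    F G H I P \<Gamma> = [\<Gamma> \<Rightarrow>\<^sub>s F, \<Gamma> \<Rightarrow>\<^sub>s G]"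
| "rule_prems DisjL    F G H I P \<Gamma> = [{#F#} + \<Gamma> \<Rightarrow>\<^sub>s H, {#G#} + \<Gamma> \<Rightarrow>\<^sub>s H]"
| "rule_prems ConjL    F G H I P \<Gamma> = [{#F, G#} + \<Gamma> \<Rightarrow>\<^sub>s H]"
| "rule_prems ImpConjL F G H I P \<Gamma> = [{#F \<rightarrow>\<^sub>f (G \<rightarrow>\<^sub>f H)#} + \<Gamma> \<Rightarrow>\<^sub>s I]"
| "rule_prems ImpDisjL F G H I P \<Gamma> = [{#F \<rightarrow>\<^sub>f H, G \<rightarrow>\<^sub>f H#} + \<Gamma> \<Rightarrow>\<^sub>s I]"
| "rule_prems DisjR1   F G H I P \<Gamma> = [\<Gamma> \<Rightarrow>\<^sub>s F]"
| "rule_prems DisjR2   F G H I P \<Gamma> = [\<Gamma> \<Rightarrow>\<^sub>s G]"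
| "rule_prems ImpAtomL F G H I P \<Gamma> = [{#F, Atom P#} + \<Gamma> \<Rightarrow>\<^sub>s G]"
| "rule_prems ImpImpL  F G H I P \<Gamma> = [{#G \<rightarrow>\<^sub>f H#} + \<Gamma> \<Rightarrow>\<^sub>s F \<rightarrow>\<^sub>f G, {#H#} + \<Gamma> \<Rightarrow>\<^sub>s I]"

fun rule_concl ::
  "rule \<Rightarrow> 'a fm \<Rightarrow> 'a fm \<Rightarrow> 'a fm \<Rightarrow> 'a fm \<Rightarrow> 'a \<Rightarrow> 'a fm multiset \<Rightarrow> 'a sequent" where
  "rule_concl Ax       F G H I P \<Gamma> = ({#Atom P#} + \<Gamma> \<Rightarrow>\<^sub>s Atom P)"
| "rule_concl ImpR     F G H I P \<Gamma> = (\<Gamma> \<Rightarrow>\<^sub>s F \<rightarrow>\<^sub>f G)"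
| "rule_concl ConjR    F G H I P \<Gamma> = (\<Gamma> \<Rightarrow>\<^sub>s F \<and>\<^sub>f G)"
| "rule_concl DisjL    F G H I P \<Gamma> = ({#F \<or>\<^sub>f G#} + \<Gamma> \<Rightarrow>\<^sub>s H)"
| "rule_concl ConjL    F G H I P \<Gamma> = ({#F \<and>\<^sub>f G#} + \<Gamma> \<Rightarrow>\<^sub>s H)"
| "rule_concl ImpConjL F G H I P \<Gamma> = ({#(G \<and>\<^sub>f F) \<rightarrow>\<^sub>f H#} + \<Gamma> \<Rightarrow>\<^sub>s I)"
| "rule_concl ImpDisjL F G H I P \<Gamma> = ({#(F \<or>\<^sub>f G) \<rightarrow>\<^sub>f H#} + \<Gamma> \<Rightarrow>\<^sub>s I)"
| "rule_concl DisjR1   F G H I P \<Gamma> = (\<Gamma> \<Rightarrow>\<^sub>s F \<or>\<^sub>f G)"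
| "rule_concl DisjR2   F G H I P \<Gamma> = (\<Gamma> \<Rightarrow>\<^sub>s F \<or>\<^sub>f G)"
| "rule_concl ImpAtomL F G H I P \<Gamma> = ({#Atom P \<rightarrow>\<^sub>f F, Atom P#} + \<Gamma> \<Rightarrow>\<^sub>s G)"
| "rule_concl ImpImpL  F G H I P \<Gamma> = ({#(F \<rightarrow>\<^sub>f G) \<rightarrow>\<^sub>f H#} + \<Gamma> \<Rightarrow>\<^sub>s I)"

text \<open>
  Invertibility of a rule is the classification by name that comes with the calculus, not the
  semantic property that derivability of the conclusion entails derivability of the premises.
\<close>

definition invertible :: "rule \<Rightarrow> bool" where
  "invertible r \<longleftrightarrow> r \<in> {ImpR, ConjR, DisjL, ConjL, ImpConjL, ImpDisjL}"

primrec fm_val :: "('a \<Rightarrow> nat) \<Rightarrow> 'a fm \<Rightarrow> nat" where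
  "fm_val v (Atom a) = v a"
| "fm_val v (A \<rightarrow>\<^sub>f B) = fm_val v B ^ fm_val v A"
| "fm_val v (A \<and>\<^sub>f B) = fm_val v A * fm_val v B"
| "fm_val v (A \<or>\<^sub>f B) = fm_val v A + fm_val v B"

definition ctx_val :: "('a \<Rightarrow> nat) \<Rightarrow> 'a fm multiset \<Rightarrow> nat" where
  "ctx_val v \<Gamma> = (\<Prod>A\<in>#\<Gamma>. fm_val v A)"

primrec seq_val :: "('a \<Rightarrow> nat) \<Rightarrow> 'a sequent \<Rightarrow> nat" where
  "seq_val v (\<Gamma> \<Rightarrow>\<^sub>s A) = fm_val v A ^ ctx_val v \<Gamma>"

definition premise_val ::
  "('a \<Rightarrow> nat) \<Rightarrow> rule \<Rightarrow> 'a fm \<Rightarrow> 'a fm \<Rightarrow> 'a fm \<Rightarrow> 'a fm \<Rightarrow> 'a \<Rightarrow> 'a fm multiset \<Rightarrow> nat" where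
  "premise_val v r F G H I P \<Gamma> = prod_list (map (seq_val v) (rule_prems r F G H I P \<Gamma>))"

definition conclusion_val ::
  "('a \<Rightarrow> nat) \<Rightarrow> rule \<Rightarrow> 'a fm \<Rightarrow> 'a fm \<Rightarrow> 'a fm \<Rightarrow> 'a fm \<Rightarrow> 'a \<Rightarrow> 'a fm multiset \<Rightarrow> nat" where
  "conclusion_val v r F G H I P \<Gamma> = seq_val v (rule_concl r F G H I P \<Gamma>)"

end

theory Submission imports Defs
begin

text \<open>
  The equalities are the laws of exponents. The only inequality that takes an argument is the one of
  the rule for nested implications on the left: with \<open>N = g ^ f\<close> and for exponent \<open>c = 1\<close>, the bound
  \<open>N \<le> i ^ (N - 2)\<close> turns the premise into a power of \<open>i\<close>, and the exponents compare as
  \<open>(N - 2) * h ^ g + h < N * h ^ g \<le> h ^ N\<close>, where the last step uses \<open>2 * g \<le> N\<close>.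
\<close>

lemma ctx_val_add_mset [simp]: "ctx_val v (add_mset A \<Gamma>) = fm_val v A * ctx_val v \<Gamma>"
  by (simp add: ctx_val_def)

lemma less_power_self:
  fixes b n :: nat
  assumes "1 < b" "1 < n"
  shows "b < b ^ n"
  using power_strict_increasing[OF assms(2,1)] by simp

text \<open>One factor of \<open>b\<close> supplies the 2; the remaining \<open>b ^ (n - 1)\<close>
  is at least \<open>2 ^ (n - 1)\<close>, which is at least \<open>n\<close>.\<close>

lemma double_le_power:
  fixes b n :: nat
  assumes "2 \<le> b" "1 \<le> n"
  shows "2 * n \<le> b ^ n"
proof -
  obtain m where n: "n = Suc m"
    using assms(2) by (cases n) auto
  have "Suc m \<le> 2 ^ m"
    using less_exp[of m] by (simp add: Suc_le_eq)
  also have "\<dots> \<le> b ^ m"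
    by (rule power_mono[OF assms(1)]) simp
  finally show ?thesis
    unfolding n power_Suc by (intro mult_mono assms(1)) simp_all
qed

text \<open>Here the 2 multiplies the base rather than the exponent, so growth in the exponent is
  not the point: the square \<open>g * g\<close> already dominates \<open>2 * g\<close>.\<close>

lemma double_le_nontrivial_power:
  fixes g f :: nat
  assumes "2 \<le> g" "2 \<le> f"
  shows "2 * g \<le> g ^ f"
proof -
  have "2 * g \<le> g ^ 2"
    using assms(1) by (simp add: power2_eq_square)
  also have "\<dots> \<le> g ^ f"
    using assms by (intro power_increasing) simp_all
  finally show ?thesis .
qed

text \<open>Four is the threshold from which \<open>n \<le> 2 * (n - 2)\<close>, so
  \<open>double_le_power\<close> at exponent \<open>n - 2\<close> suffices.\<close>

lemma le_power_diff_two: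
  fixes b n :: nat
  assumes "2 \<le> b" "4 \<le> n"
  shows "n \<le> b ^ (n - 2)"
  using double_le_power[of b "n - 2"] assms by linarith

lemma tower_exponents_less:
  fixes g h n :: nat
  assumes g: "2 \<le> g" and h: "2 \<le> h" and n: "2 * g \<le> n"
  shows "(n - 2) * h ^ g + h < h ^ n"
proof -
  \<comment> \<open>The only strict step of the chain: \<open>h < h ^ g\<close> because both are
    nontrivial.\<close>
  have "(n - 2) * h ^ g + h < (n - 2) * h ^ g + h ^ g"
    using less_power_self[of h g] g h by simp
  also have "\<dots> \<le> n * h ^ g"
  proof -
    \<comment> \<open>Truncated subtraction could break this only at \<open>n = 0\<close>, which
      \<open>g\<close> and \<open>n\<close> exclude.\<close>
    have "Suc (n - 2) \<le> n"
      using g n by linarith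
    from mult_le_mono1[OF this, of "h ^ g"] show ?thesis
      by simp
  qed
  \<comment> \<open>The hypothesis \<open>2 * g \<le> n\<close> is the same as
    \<open>n \<le> 2 * (n - g)\<close>, and \<open>double_le_power\<close> bounds the latter by
    \<open>h ^ (n - g)\<close>.\<close>
  also have "\<dots> \<le> h ^ (n - g) * h ^ g"
    using double_le_power[of h "n - g"] g h n by (intro mult_le_mono1) linarith
  also have "\<dots> = h ^ n"
    using n by (simp flip: power_add)
  finally show ?thesis .
qed

lemma imp_imp_left_less:
  fixes f g h i c :: nat
  assumes f: "2 \<le> f" and g: "2 \<le> g" and h: "2 \<le> h" and i: "2 \<le> i" and c: "1 \<le> c"
  shows "(g ^ f) ^ (h ^ g * c) * i ^ (h * c) < i ^ (h ^ (g ^ f) * c)"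
proof -
  define n where "n = g ^ f"
  have n: "2 * g \<le> n"
    unfolding n_def by (rule double_le_nontrivial_power[OF g f])
  \<comment> \<open>The bound on \<open>n\<close> applies since \<open>2 * g \<le> n\<close> and
    \<open>2 \<le> g\<close> give \<open>4 \<le> n\<close>.\<close>
  have "n ^ (h ^ g) * i ^ h \<le> (i ^ (n - 2)) ^ (h ^ g) * i ^ h"
    using le_power_diff_two[of i n] g i n by (intro mult_le_mono1 power_mono) simp_all
  also have "\<dots> = i ^ ((n - 2) * h ^ g + h)"
    by (simp add: power_add power_mult)
  also have "\<dots> < i ^ (h ^ n)"
    using tower_exponents_less[OF g h n] i by (intro power_strict_increasing) simp_all
  \<comment> \<open>The context enters both sides only as the outer exponent \<open>c\<close>, and a
    positive exponent preserves strictness.\<close>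
  finally have "(n ^ (h ^ g) * i ^ h) ^ c < (i ^ (h ^ n)) ^ c"
    using c by (intro power_strict_mono) simp_all
  then show ?thesis
    by (simp add: power_mult_distrib n_def mult.assoc flip: power_mult)
qed

theorem theorem6:
  fixes f g h i p c :: nat
  assumes "f > 1" and "g > 1" and "h > 1" and "i > 1" and "p > 1" and "c \<ge> 1"
  shows
   "(\<forall>(v :: 'a \<Rightarrow> nat) F G H I P \<Gamma>.
       fm_val v F = f \<and> fm_val v G = g \<and> fm_val v H = h \<and> fm_val v I = i \<and>
       fm_val v (Atom P) = p \<and> ctx_val v \<Gamma> = c \<longrightarrow>
         (\<forall>r. premise_val v r F G H I P \<Gamma> \<le> conclusion_val v r F G H I P \<Gamma> \<and>
              (premise_val v r F G H I P \<Gamma> < conclusion_val v r F G H I P \<Gamma> \<longleftrightarrow>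
                 \<not> invertible r)) \<and>
         premise_val v ImpR F G H I P \<Gamma> = g ^ (f * c) \<and>
         conclusion_val v ImpR F G H I P \<Gamma> = (g ^ f) ^ c \<and>
         premise_val v ConjR F G H I P \<Gamma> = f ^ c * g ^ c \<and>
         conclusion_val v ConjR F G H I P \<Gamma> = (f * g) ^ c \<and>
         premise_val v DisjL F G H I P \<Gamma> = h ^ (f * c) * h ^ (g * c) \<and>
         conclusion_val v DisjL F G H I P \<Gamma> = h ^ ((f + g) * c) \<and>
         premise_val v ConjL F G H I P \<Gamma> = h ^ (f * g * c) \<and>
         conclusion_val v ConjL F G H I P \<Gamma> = h ^ (f * g * c) \<and>
         premise_val v ImpConjL F G H I P \<Gamma> = i ^ ((h ^ g) ^ f * c) \<and>
         conclusion_val v ImpConjL F G H I P \<Gamma> = i ^ (h ^ (g * f) * c) \<and>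
         premise_val v ImpDisjL F G H I P \<Gamma> = i ^ (h ^ f * h ^ g * c) \<and>
         conclusion_val v ImpDisjL F G H I P \<Gamma> = i ^ (h ^ (f + g) * c) \<and>
         premise_val v Ax F G H I P \<Gamma> = 1 \<and>
         conclusion_val v Ax F G H I P \<Gamma> = p ^ (p * c) \<and>
         premise_val v DisjR1 F G H I P \<Gamma> = f ^ c \<and>
         conclusion_val v DisjR1 F G H I P \<Gamma> = (f + g) ^ c \<and>
         premise_val v DisjR2 F G H I P \<Gamma> = g ^ c \<and>
         conclusion_val v DisjR2 F G H I P \<Gamma> = (f + g) ^ c \<and>
         premise_val v ImpAtomL F G H I P \<Gamma> = g ^ (f * p * c) \<and>
         conclusion_val v ImpAtomL F G H I P \<Gamma> = g ^ (f ^ p * p * c) \<and>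
         premise_val v ImpImpL F G H I P \<Gamma> = (g ^ f) ^ (h ^ g * c) * i ^ (h * c) \<and>
         conclusion_val v ImpImpL F G H I P \<Gamma> = i ^ (h ^ (g ^ f) * c)) \<and>
    g ^ (f * c) = (g ^ f) ^ c \<and>
    f ^ c * g ^ c = (f * g) ^ c \<and>
    h ^ (f * c) * h ^ (g * c) = h ^ ((f + g) * c) \<and>
    h ^ (f * g * c) = h ^ (f * g * c) \<and>
    i ^ ((h ^ g) ^ f * c) = i ^ (h ^ (g * f) * c) \<and>
    i ^ (h ^ f * h ^ g * c) = i ^ (h ^ (f + g) * c) \<and>
    1 < p ^ (p * c) \<and>
    f ^ c < (f + g) ^ c \<and>
    g ^ c < (f + g) ^ c \<and>
    g ^ (f * p * c) < g ^ (f ^ p * p * c) \<and>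
    (g ^ f) ^ (h ^ g * c) * i ^ (h * c) < i ^ (h ^ (g ^ f) * c)"
  (is "(\<forall>v F G H I P \<Gamma>. ?A v F G H I P \<Gamma> \<longrightarrow> ?B v F G H I P \<Gamma> \<and> ?C v F G H I P \<Gamma>) \<and> ?ineqs")
proof -
  have ineqs: ?ineqs
  proof (intro conjI)
    show "1 < p ^ (p * c)"
      using assms by (intro one_less_power) simp_all
    show "f ^ c < (f + g) ^ c" "g ^ c < (f + g) ^ c"
      using assms by (auto intro!: power_strict_mono)
    show "g ^ (f * p * c) < g ^ (f ^ p * p * c)"
      \<comment> \<open>Strictness comes from the exponents: \<open>f < f ^ p\<close>, multiplied by
        the positive \<open>p * c\<close>.\<close>
      using assms less_power_self[of f p] by (intro power_strict_increasing) simp_all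
    show "(g ^ f) ^ (h ^ g * c) * i ^ (h * c) < i ^ (h ^ (g ^ f) * c)"
      using assms by (intro imp_imp_left_less) simp_all
    show "i ^ ((h ^ g) ^ f * c) = i ^ (h ^ (g * f) * c)"
      by (simp add: power_mult)
  qed (simp_all add: power_mult power_mult_distrib power_add add_mult_distrib)
  have "?B v F G H I P \<Gamma> \<and> ?C v F G H I P \<Gamma>" if "?A v F G H I P \<Gamma>"
    for v :: "'a \<Rightarrow> nat" and F G H I P \<Gamma>
  proof -
    \<comment> \<open>\<open>ctx_val_add_mset\<close> peels the displayed formulas off each context,
      and \<open>mult.assoc\<close> brackets the products in the exponents alike.\<close>
    have vals: "?C v F G H I P \<Gamma>"
      using that by (simp add: premise_val_def conclusion_val_def mult.assoc)
    have "?B v F G H I P \<Gamma>"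
    proof
      fix r
      show "premise_val v r F G H I P \<Gamma> \<le> conclusion_val v r F G H I P \<Gamma> \<and>
        (premise_val v r F G H I P \<Gamma> < conclusion_val v r F G H I P \<Gamma> \<longleftrightarrow> \<not> invertible r)"
        \<comment> \<open>Each rule has its two values in \<open>vals\<close>; the matching equality
          or strict inequality in \<open>ineqs\<close> then settles both conjuncts.\<close>
        using vals ineqs by (cases r) (simp_all only: invertible_def, auto)
    qed
    with vals show ?thesis by blast
  qed
  with ineqs show ?thesis by blast
qed

end
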